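(* Let $\tau\in\mathbb H$. No $\mathrm{MU}$-orientation of the complex analytic elliptic cohomology theory $\mathrm{Ell}_\tau$ may be refined to an equivariant $\mathrm{MU}$-orientation of the corresponding complex analytic equivariant elliptic cohomology theory defined over $E_\tau^\vee$. That is, for every $\mathrm{MU}$-orientation $\tilde{\mathsf c}$ of $\mathrm{Ell}_\tau$, with degree zero class $\mathsf c=\beta\tilde{\mathsf c}\in\mathrm{Ell}_\tau^0(\mathbb{CP}^\infty)$, there is no global section $\mathsf c_{\mathrm U(1)}\in\Gamma(E_\tau^\vee;\mathcal O_{E_\tau^\vee})=\Gamma(\mathrm{Ell}_{\mathrm U(1)}(\mathrm{pt})|_{E_\tau^\vee})$ whose image under the completion map to $\mathrm{Ell}_\tau(B\mathrm U(1))=\mathrm{Ell}_\tau(\mathbb{CP}^\infty)$ is $\mathsf c$.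
   Context: $E_\tau=\mathbb C/(\mathbb Z\oplus\tau\mathbb Z)$ is a complex elliptic curve and $E_\tau^\vee$ its dual, also a quotient of $\mathbb C$ (with coordinate $z$) by $\mathbb Z\oplus\tau\mathbb Z$. $\mathrm{Ell}_\tau$ is the elliptic cohomology theory with underlying cohomology theory $H(-;\mathbb C[\beta,\beta^{-1}])$, $|\beta|=-2$, whose formal group $\mathrm{Spf}\,\mathrm{Ell}_\tau^0(\mathbb{CP}^\infty)$ (the additive formal group) is identified with the formal completion of the elliptic curve at its identity via the quotient map from $\mathbb C$. Thus $\mathrm{Ell}_\tau^0(\mathbb{CP}^\infty)\simeq\mathbb C[\![z]\!]$ is the ring of functions on the formal neighborhood of $0$. An $\mathrm{MU}$-orientation (complex orientation) of a multiplicative cohomology theory $h$ is an element $\tilde{\mathsf c}\in\tilde h^2(\mathbb{CP}^\infty)$ whose restriction to $\mathbb{CP}^1=S^2$ is the canonical generator of $\tilde h^2(S^2)\simeq h^0(\mathrm{pt})$; then $\mathsf c=\beta\tilde{\mathsf c}$ is a coordinate, i.e. a formal function vanishing to exactly first order at $0$. The $\mathrm U(1)$-equivariant elliptic cohomology of a point at the curve $E_\tau$ is, in degree $0$, the sheaf $\mathcal O_{E_\tau^\vee}$ of holomorphic functions on $E_\tau^\vee$, and the (Atiyah–Segal type) completion map takes a section to its Taylor expansion at $0\in E_\tau^\vee$. An equivariant refinement of the orientation is a global section mapping to $\mathsf c$ under completion. *)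

theory Defs
  imports "HOL-Complex_Analysis.Complex_Analysis" "HOL-Homology.Homology"
begin

section \<open>Singular cohomology with complex coefficients\<close>

text \<open>
  Cochains are graded by \<^typ>\<open>int\<close>, and a cochain is a function on all maps into \<open>X\<close>
  that vanishes off the singular simplices.  In negative degrees \<open>0\<close> is the only cochain.
\<close>

type_synonym 'a cochain = "((nat \<Rightarrow> real) \<Rightarrow> 'a) \<Rightarrow> complex"

definition cochains :: "int \<Rightarrow> 'a topology \<Rightarrow> 'a cochain set" where
  "cochains k X = {\<phi>. \<forall>\<sigma>. \<phi> \<sigma> \<noteq> 0 \<longrightarrow> 0 \<le> k \<and> singular_simplex (nat k) X \<sigma>}"

definition pairing :: "'a cochain \<Rightarrow> 'a chain \<Rightarrow> complex" where
  "pairing \<phi> c = (\<Sum>\<sigma>\<in>Poly_Mapping.keys c. of_int (Poly_Mapping.lookup c \<sigma>) * \<phi> \<sigma>)"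

definition coboundary :: "int \<Rightarrow> 'a topology \<Rightarrow> 'a cochain \<Rightarrow> 'a cochain" where
  "coboundary k X \<phi> = (\<lambda>\<sigma>. if 0 \<le> k \<and> singular_simplex (nat (k + 1)) X \<sigma>
                            then pairing \<phi> (chain_boundary (nat (k + 1)) (frag_of \<sigma>)) else 0)"

definition cocycles :: "int \<Rightarrow> 'a topology \<Rightarrow> 'a cochain set" where
  "cocycles k X = {\<phi> \<in> cochains k X. coboundary k X \<phi> = (\<lambda>\<sigma>. 0)}"

definition coboundaries :: "int \<Rightarrow> 'a topology \<Rightarrow> 'a cochain set" where
  "coboundaries k X = coboundary (k - 1) X ` cochains (k - 1) X"

definition cocycle_group :: "int \<Rightarrow> 'a topology \<Rightarrow> 'a cochain monoid" where
  "cocycle_group k X =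
     \<lparr>carrier = cocycles k X, mult = (\<lambda>\<phi> \<psi> \<sigma>. \<phi> \<sigma> + \<psi> \<sigma>), one = (\<lambda>\<sigma>. 0)\<rparr>"

definition cohomology_group :: "int \<Rightarrow> 'a topology \<Rightarrow> 'a cochain set monoid" where
  "cohomology_group k X = cocycle_group k X Mod coboundaries k X"

definition cohomology_class :: "int \<Rightarrow> 'a topology \<Rightarrow> 'a cochain \<Rightarrow> 'a cochain set" where
  "cohomology_class k X \<phi> = coboundaries k X #>\<^bsub>cocycle_group k X\<^esub> \<phi>"

text \<open>
  Operations on classes are defined as unions over all representatives.  The sets being united
  all coincide, because each operation is well defined on cohomology.
\<close>

definition class_scale :: "int \<Rightarrow> 'a topology \<Rightarrow> complex \<Rightarrow> 'a cochain set \<Rightarrow> 'a cochain set" where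
  "class_scale k X a u = (\<Union>\<phi>\<in>u. cohomology_class k X (\<lambda>\<sigma>. a * \<phi> \<sigma>))"

definition cochain_pullback ::
    "int \<Rightarrow> 'a topology \<Rightarrow> ('a \<Rightarrow> 'b) \<Rightarrow> 'b cochain \<Rightarrow> 'a cochain" where
  "cochain_pullback k X f \<phi> =
     (\<lambda>\<sigma>. if 0 \<le> k \<and> singular_simplex (nat k) X \<sigma> then \<phi> (simplex_map (nat k) f \<sigma>) else 0)"

definition class_pullback ::
    "int \<Rightarrow> 'a topology \<Rightarrow> ('a \<Rightarrow> 'b) \<Rightarrow> 'b cochain set \<Rightarrow> 'a cochain set" where
  "class_pullback k X f u = (\<Union>\<phi>\<in>u. cohomology_class k X (cochain_pullback k X f \<phi>))"

definition front_face :: "nat \<Rightarrow> ((nat \<Rightarrow> real) \<Rightarrow> 'a) \<Rightarrow> (nat \<Rightarrow> real) \<Rightarrow> 'a" where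
  "front_face p \<sigma> = restrict \<sigma> (standard_simplex p)"

definition back_face :: "nat \<Rightarrow> nat \<Rightarrow> ((nat \<Rightarrow> real) \<Rightarrow> 'a) \<Rightarrow> (nat \<Rightarrow> real) \<Rightarrow> 'a" where
  "back_face p q \<sigma> = restrict (\<lambda>t. \<sigma> (\<lambda>i. if i < p then 0 else t (i - p))) (standard_simplex q)"

definition cochain_cup ::
    "'a topology \<Rightarrow> nat \<Rightarrow> nat \<Rightarrow> 'a cochain \<Rightarrow> 'a cochain \<Rightarrow> 'a cochain" where
  "cochain_cup X p q \<phi> \<psi> = (\<lambda>\<sigma>. if singular_simplex (p + q) X \<sigma>
                                  then \<phi> (front_face p \<sigma>) * \<psi> (back_face p q \<sigma>) else 0)"

definition class_cup ::
    "'a topology \<Rightarrow> nat \<Rightarrow> nat \<Rightarrow> 'a cochain set \<Rightarrow> 'a cochain set \<Rightarrow> 'a cochain set" where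
  "class_cup X p q u v =
     (\<Union>\<phi>\<in>u. \<Union>\<psi>\<in>v. cohomology_class (int (p + q)) X (cochain_cup X p q \<phi> \<psi>))"

definition class_one :: "'a topology \<Rightarrow> 'a cochain set" where
  "class_one X = cohomology_class 0 X (\<lambda>\<sigma>. if singular_simplex 0 X \<sigma> then 1 else 0)"

text \<open>\<open>n\<close>-th cup power of a class of degree \<open>2\<close>; it has degree \<open>2 * n\<close>.\<close>

primrec cup_power :: "'a topology \<Rightarrow> 'a cochain set \<Rightarrow> nat \<Rightarrow> 'a cochain set" where
  "cup_power X u 0 = class_one X"
| "cup_power X u (Suc n) = class_cup X 2 (2 * n) u (cup_power X u n)"


section \<open>The cohomology theory \<open>H(-; \<complex>[\<beta>, \<beta>\<^sup>-\<^sup>1])\<close>\<close>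

text \<open>
  Since \<open>\<beta>\<close> has degree \<open>-2\<close>, a class of degree \<open>k\<close> is a formal sum of terms \<open>u\<^sub>j \<beta>\<^sup>j\<close>,
  where \<open>j\<close> ranges over \<^typ>\<open>int\<close> and \<open>u\<^sub>j\<close> is an ordinary class of degree \<open>k + 2 * j\<close>.
  It is encoded as the family \<open>u\<close>.  The representable theory is the product, not the direct sum,
  over \<open>j\<close>; on \<open>\<complex>P\<^sup>\<infinity>\<close> this is what gives power series rather than polynomials.
\<close>

definition Ell :: "int \<Rightarrow> 'a topology \<Rightarrow> (int \<Rightarrow> 'a cochain set) set" where
  "Ell k X = {u. \<forall>j. u j \<in> carrier (cohomology_group (k + 2 * j) X)}"

definition Ell_zero :: "int \<Rightarrow> 'a topology \<Rightarrow> int \<Rightarrow> 'a cochain set" where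
  "Ell_zero k X = (\<lambda>j. \<one>\<^bsub>cohomology_group (k + 2 * j) X\<^esub>)"

definition Ell_pullback ::
    "int \<Rightarrow> 'a topology \<Rightarrow> ('a \<Rightarrow> 'b) \<Rightarrow> (int \<Rightarrow> 'b cochain set) \<Rightarrow> int \<Rightarrow> 'a cochain set" where
  "Ell_pullback k X f u = (\<lambda>j. class_pullback (k + 2 * j) X f (u j))"

definition Ell_reduced :: "int \<Rightarrow> 'a topology \<Rightarrow> 'a \<Rightarrow> (int \<Rightarrow> 'a cochain set) set" where
  "Ell_reduced k X a =
     {u \<in> Ell k X. Ell_pullback k (subtopology X {a}) id u = Ell_zero k (subtopology X {a})}"

text \<open>Multiplication by \<open>\<beta>\<close>, from degree \<open>k\<close> to degree \<open>k - 2\<close>.\<close>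

definition beta_mult :: "(int \<Rightarrow> 'a cochain set) \<Rightarrow> int \<Rightarrow> 'a cochain set" where
  "beta_mult u = (\<lambda>j. u (j - 1))"


section \<open>Complex projective spaces\<close>

text \<open>
  Points are complex lines in the space of finitely supported sequences.  \<open>CP n\<close> carries the
  quotient topology from \<open>\<complex>\<^sup>n\<^sup>+\<^sup>1 - {0}\<close>, and \<open>CP_inf\<close> the colimit topology.
\<close>

definition nonzero_vectors :: "nat \<Rightarrow> (nat \<Rightarrow> complex) set" where
  "nonzero_vectors n = {v. (\<exists>i. v i \<noteq> 0) \<and> (\<forall>i>n. v i = 0)}"

definition complex_line :: "(nat \<Rightarrow> complex) \<Rightarrow> (nat \<Rightarrow> complex) set" where
  "complex_line v = {w. \<exists>a. w = (\<lambda>i. a * v i)}"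

definition CP :: "nat \<Rightarrow> (nat \<Rightarrow> complex) set topology" where
  "CP n = topology (\<lambda>U. U \<subseteq> complex_line ` nonzero_vectors n \<and>
            openin (top_of_set (nonzero_vectors n)) {v \<in> nonzero_vectors n. complex_line v \<in> U})"

definition CP_inf :: "(nat \<Rightarrow> complex) set topology" where
  "CP_inf = topology (\<lambda>U. U \<subseteq> (\<Union>n. topspace (CP n)) \<and> (\<forall>n. openin (CP n) (U \<inter> topspace (CP n))))"

lemma istopology_CP:
  "istopology (\<lambda>U. U \<subseteq> complex_line ` nonzero_vectors n \<and>
     openin (top_of_set (nonzero_vectors n)) {v \<in> nonzero_vectors n. complex_line v \<in> U})"
proof -
  have 1: "{v \<in> A. f v \<in> S \<inter> T} = {v \<in> A. f v \<in> S} \<inter> {v \<in> A. f v \<in> T}" for A and f :: "(nat \<Rightarrow> complex) \<Rightarrow> (nat \<Rightarrow> complex) set" and S T by auto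
  have 2: "{v \<in> A. f v \<in> \<Union>K} = \<Union>((\<lambda>S. {v \<in> A. f v \<in> S}) ` K)" for A and f :: "(nat \<Rightarrow> complex) \<Rightarrow> (nat \<Rightarrow> complex) set" and K by auto
  show ?thesis
    unfolding istopology_def 1 2 by (auto intro!: openin_Int openin_Union)
qed

lemma openin_CP: "openin (CP n) U \<longleftrightarrow> U \<subseteq> complex_line ` nonzero_vectors n \<and>
     openin (top_of_set (nonzero_vectors n)) {v \<in> nonzero_vectors n. complex_line v \<in> U}"
  unfolding CP_def using istopology_CP[of n] by (simp add: topology_inverse')

lemma topspace_CP: "topspace (CP n) = complex_line ` nonzero_vectors n"
proof -
  have "openin (CP n) (complex_line ` nonzero_vectors n)"
  proof -
    have "{v \<in> nonzero_vectors n. complex_line v \<in> complex_line ` nonzero_vectors n} = nonzero_vectors n" by auto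
    then show ?thesis unfolding openin_CP by simp
  qed
  then show ?thesis using openin_CP by (metis openin_subset openin_topspace subset_antisym)
qed

lemma istopology_CP_inf:
  "istopology (\<lambda>U. U \<subseteq> (\<Union>n. topspace (CP n)) \<and> (\<forall>n. openin (CP n) (U \<inter> topspace (CP n))))"
proof -
  have 1: "openin (CP n) (S \<inter> T \<inter> topspace (CP n))"
    if "openin (CP n) (S \<inter> topspace (CP n))" "openin (CP n) (T \<inter> topspace (CP n))" for n S T
    using openin_Int[OF that] by (simp add: Int_ac)
  have 2: "openin (CP n) (\<Union>K \<inter> topspace (CP n))"
    if "\<forall>S\<in>K. openin (CP n) (S \<inter> topspace (CP n))" for n K
  proof -
    have "openin (CP n) (\<Union>((\<lambda>S. S \<inter> topspace (CP n)) ` K))"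
      using that by (intro openin_Union) blast
    then show ?thesis by (simp only: Int_Union2)
  qed
  show ?thesis
    unfolding istopology_def
  proof (intro conjI allI impI)
    fix S T n
    assume "S \<subseteq> (\<Union>n. topspace (CP n)) \<and> (\<forall>n. openin (CP n) (S \<inter> topspace (CP n)))"
      and "T \<subseteq> (\<Union>n. topspace (CP n)) \<and> (\<forall>n. openin (CP n) (T \<inter> topspace (CP n)))"
    then show "openin (CP n) (S \<inter> T \<inter> topspace (CP n))" and "S \<inter> T \<subseteq> (\<Union>n. topspace (CP n))"
      using 1 by blast+
  next
    fix K n
    assume "\<forall>S\<in>K. S \<subseteq> (\<Union>n. topspace (CP n)) \<and> (\<forall>n. openin (CP n) (S \<inter> topspace (CP n)))"
    then show "openin (CP n) (\<Union>K \<inter> topspace (CP n))" and "\<Union>K \<subseteq> (\<Union>n. topspace (CP n))"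
      using 2 by blast+
  qed
qed

lemma openin_CP_inf:
  "openin CP_inf U \<longleftrightarrow>
     U \<subseteq> (\<Union>n. topspace (CP n)) \<and> (\<forall>n. openin (CP n) (U \<inter> topspace (CP n)))"
  unfolding CP_inf_def topology_inverse'[OF istopology_CP_inf] by (rule refl)

lemma continuous_map_complex_line:
  "continuous_map (top_of_set (nonzero_vectors n)) (CP n) complex_line"
  unfolding continuous_map_def topspace_CP by (auto simp: openin_CP)

definition CP_basepoint :: "(nat \<Rightarrow> complex) set" where
  "CP_basepoint = complex_line (\<lambda>i. if i = 0 then 1 else 0)"

text \<open>
  The canonical generator of the reduced cohomology of \<open>CP 1 = S\<^sup>2\<close>.  The singular simplex
  \<open>CP1_simplex\<close> sends the boundary of the triangle to the single point \<open>[0 : 1]\<close>.  Its interior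
  is mapped homeomorphically, preserving orientation, onto the affine line with coordinate
  \<open>v\<^sub>1 / v\<^sub>0\<close>, namely by
  \<open>t \<mapsto> ((t\<^sub>1 - t\<^sub>0) + \<i> (t\<^sub>2 - t\<^sub>0)) / (t\<^sub>0 t\<^sub>1 t\<^sub>2)\<close>.
  It thus realises the identification of \<open>\<Delta>\<^sup>2 / \<partial>\<Delta>\<^sup>2\<close> with \<open>S\<^sup>2\<close>.  Subtracting the constant simplex
  makes it a cycle, the fundamental cycle.  Pairing with it is the suspension isomorphism
  from the reduced degree \<open>2\<close> cohomology of \<open>S\<^sup>2\<close> to the degree \<open>0\<close> cohomology of a point,
  and the canonical generator is the class that is sent to \<open>1\<close>.
\<close>

definition CP1_simplex :: "(nat \<Rightarrow> real) \<Rightarrow> (nat \<Rightarrow> complex) set" where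
  "CP1_simplex = restrict (\<lambda>t. complex_line (\<lambda>i.
       if i = 0 then of_real (t 0 * t 1 * t 2)
       else if i = 1 then Complex (t 1 - t 0) (t 2 - t 0)
       else 0)) (standard_simplex 2)"

definition CP1_fundamental_cycle :: "(nat \<Rightarrow> complex) set chain" where
  "CP1_fundamental_cycle =
     frag_of CP1_simplex -
     frag_of (restrict (\<lambda>t. complex_line (\<lambda>i. if i = 1 then 1 else 0)) (standard_simplex 2))"

lemma standard_simplex_2_sum: "t \<in> standard_simplex 2 \<Longrightarrow> t 0 + t 1 + t 2 = 1"
  by (simp add: standard_simplex_def numeral_2_eq_2)

lemma singular_simplex_CP1_simplex: "singular_simplex 2 (CP 1) CP1_simplex"
proof -
  define g where "g = (\<lambda>(t::nat\<Rightarrow>real) i::nat. if i = 0 then of_real (t 0 * t 1 * t 2)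
       else if i = 1 then Complex (t 1 - t 0) (t 2 - t 0) else 0)"
  have nz: "g t \<in> nonzero_vectors 1" if "t \<in> standard_simplex 2" for t
  proof -
    have "\<exists>i. g t i \<noteq> 0"
    proof (rule ccontr)
      assume "\<nexists>i. g t i \<noteq> 0"
      then have "g t 0 = 0" "g t 1 = 0" by auto
      then show False using standard_simplex_2_sum[OF that] by (auto simp: g_def complex_eq_iff)
    qed
    then show ?thesis by (auto simp: nonzero_vectors_def g_def)
  qed
  have "continuous_map (subtopology (powertop_real UNIV) (standard_simplex 2)) euclidean g"
  proof -
    have eq: "(powertop_real UNIV :: (nat \<Rightarrow> real) topology) = euclidean"
      by (simp add: euclidean_product_topology)
    have c: "continuous_on (standard_simplex 2) (\<lambda>t::nat\<Rightarrow>real. t k)" for k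
      by (rule continuous_on_subset[OF continuous_on_product_coordinates]) auto
    have "continuous_on (standard_simplex 2) g"
    proof (rule continuous_on_coordinatewise_then_product)
      fix i :: nat
      consider "i = 0" | "i = 1" | "i > 1" by linarith
      then show "continuous_on (standard_simplex 2) (\<lambda>t. g t i)"
        by cases (simp_all add: g_def Complex_eq continuous_on_mult continuous_on_add continuous_on_diff continuous_on_of_real c)
    qed
    then show ?thesis by (simp add: eq)
  qed
  then have "continuous_map (subtopology (powertop_real UNIV) (standard_simplex 2)) (top_of_set (nonzero_vectors 1)) g"
    using nz by (auto simp: continuous_map_in_subtopology)
  from continuous_map_compose[OF this continuous_map_complex_line]
  have "continuous_map (subtopology (powertop_real UNIV) (standard_simplex 2)) (CP 1) (complex_line \<circ> g)" .
  then have "continuous_map (subtopology (powertop_real UNIV) (standard_simplex 2)) (CP 1) CP1_simplex"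
    by (rule continuous_map_eq) (auto simp: CP1_simplex_def g_def)
  then show ?thesis by (auto simp: singular_simplex_def CP1_simplex_def)
qed

lemma complex_line_scale: assumes "a \<noteq> 0" shows "complex_line (\<lambda>i. a * v i) = complex_line v"
proof (intro equalityI subsetI)
  fix w assume "w \<in> complex_line (\<lambda>i. a * v i)"
  then obtain b where "w = (\<lambda>i. b * (a * v i))" unfolding complex_line_def by blast
  then have "w = (\<lambda>i. (b * a) * v i)" by (simp add: mult.assoc)
  then show "w \<in> complex_line v" unfolding complex_line_def by blast
next
  fix w assume "w \<in> complex_line v"
  then obtain b where "w = (\<lambda>i. b * v i)" unfolding complex_line_def by blast
  then have "w = (\<lambda>i. (b / a) * (a * v i))" using assms by simp
  then show "w \<in> complex_line (\<lambda>i. a * v i)" unfolding complex_line_def by blast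
qed

lemma complex_line_infinity: assumes "a \<noteq> 0" shows "complex_line (\<lambda>i. if i = 1 then a else 0) = complex_line (\<lambda>i. if i = (1::nat) then 1 else 0)"
proof -
  have "(\<lambda>i. if i = 1 then a else 0) = (\<lambda>i. a * (if i = (1::nat) then 1 else 0))" by auto
  then show ?thesis using complex_line_scale[OF assms, of "\<lambda>i. if i = (1::nat) then 1 else 0"] by (simp only:)
qed

lemma singular_simplex_CP1_constant: "singular_simplex 2 (CP 1) (restrict (\<lambda>t. complex_line (\<lambda>i. if i = 1 then 1 else 0)) (standard_simplex 2))"
proof -
  have "complex_line (\<lambda>i. if i = 1 then 1 else 0) \<in> topspace (CP 1)"
    by (auto simp: topspace_CP nonzero_vectors_def)
  then have "continuous_map (subtopology (powertop_real UNIV) (standard_simplex 2)) (CP 1) (\<lambda>t. complex_line (\<lambda>i. if i = 1 then 1 else 0))"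
    by simp
  then have "continuous_map (subtopology (powertop_real UNIV) (standard_simplex 2)) (CP 1) (restrict (\<lambda>t. complex_line (\<lambda>i. if i = 1 then 1 else 0)) (standard_simplex 2))"
    by (rule continuous_map_eq) simp
  then show ?thesis unfolding singular_simplex_def by simp
qed

lemma singular_face_CP1_simplex: assumes "k \<le> 2"
  shows "singular_face 2 k CP1_simplex = restrict (\<lambda>t. complex_line (\<lambda>i. if i = 1 then 1 else 0)) (standard_simplex 1)"
proof
  fix t
  show "singular_face 2 k CP1_simplex t = restrict (\<lambda>t. complex_line (\<lambda>i. if i = 1 then 1 else 0)) (standard_simplex 1) t"
  proof (cases "t \<in> standard_simplex 1")
    case True
    define s where "s = simplical_face k t"
    have s: "s \<in> standard_simplex 2" unfolding s_def
      using simplical_face_in_standard_simplex[of 2 k t] True assms by simp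
    have "s k = 0" by (simp add: s_def simplical_face_def)
    then have p: "s 0 * s 1 * s 2 = 0" using assms by (auto simp: le_Suc_eq numeral_2_eq_2)
    have "Complex (s 1 - s 0) (s 2 - s 0) \<noteq> 0" 
      using p standard_simplex_2_sum[OF s] by (auto simp: complex_eq_iff)
    then have "complex_line (\<lambda>i. if i = 1 then Complex (s 1 - s 0) (s 2 - s 0) else 0) = complex_line (\<lambda>i. if i = (1::nat) then 1 else 0)"
      by (rule complex_line_infinity)
    moreover have "(\<lambda>i. if i = 0 then complex_of_real (s 0 * s 1 * s 2) else if i = 1 then Complex (s 1 - s 0) (s 2 - s 0) else 0)
       = (\<lambda>i. if i = (1::nat) then Complex (s 1 - s 0) (s 2 - s 0) else 0)" unfolding p by auto
    ultimately have "CP1_simplex s = complex_line (\<lambda>i. if i = (1::nat) then 1 else 0)"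
      using s by (simp add: CP1_simplex_def del: of_real_mult)
    then show ?thesis using True by (simp add: singular_face_def s_def)
  qed (simp add: singular_face_def)
qed

lemma singular_face_constant: assumes "k \<le> 2"
  shows "singular_face 2 k (restrict (\<lambda>t. c) (standard_simplex 2)) = restrict (\<lambda>t. c) (standard_simplex 1)"
  using simplical_face_in_standard_simplex[of 2 k] assms
  by (auto simp: fun_eq_iff singular_face_def restrict_def)

lemma singular_relcycle_CP1_fundamental_cycle: "singular_relcycle 2 (CP 1) {} CP1_fundamental_cycle"
proof -
  have "chain_boundary 2 CP1_fundamental_cycle = 0"
    unfolding CP1_fundamental_cycle_def chain_boundary_diff chain_boundary_of right_minus_eq
    by (intro if_cong sum.cong refl) (simp_all only: atMost_iff singular_face_CP1_simplex singular_face_constant)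
  moreover have "singular_chain 2 (CP 1) CP1_fundamental_cycle"
    unfolding CP1_fundamental_cycle_def
    by (intro singular_chain_diff; unfold singular_chain_of; rule singular_simplex_CP1_simplex singular_simplex_CP1_constant)
  ultimately show ?thesis by (simp add: singular_relcycle_def)
qed

definition is_generator_CP1 :: "(nat \<Rightarrow> complex) set cochain set \<Rightarrow> bool" where
  "is_generator_CP1 u \<longleftrightarrow> u \<in> carrier (cohomology_group 2 (CP 1)) \<and>
     (\<forall>\<phi>\<in>u. pairing \<phi> CP1_fundamental_cycle = 1)"

definition is_Ell_generator_CP1 :: "(int \<Rightarrow> (nat \<Rightarrow> complex) set cochain set) \<Rightarrow> bool" where
  "is_Ell_generator_CP1 u \<longleftrightarrow>
     u \<in> Ell_reduced 2 (CP 1) CP_basepoint \<and> is_generator_CP1 (u 0) \<and>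
     (\<forall>j. j \<noteq> 0 \<longrightarrow> u j = Ell_zero 2 (CP 1) j)"


section \<open>Orientations and the coordinate ring of the formal group\<close>

definition MU_orientation :: "(int \<Rightarrow> (nat \<Rightarrow> complex) set cochain set) \<Rightarrow> bool" where
  "MU_orientation c \<longleftrightarrow>
     c \<in> Ell_reduced 2 CP_inf CP_basepoint \<and> is_Ell_generator_CP1 (Ell_pullback 2 (CP 1) id c)"

text \<open>
  The class in ordinary cohomology of degree \<open>2\<close> that restricts to the canonical generator on
  \<open>CP 1\<close>; it is unique because this restriction map is an isomorphism.
\<close>

definition hyperplane_class :: "(nat \<Rightarrow> complex) set cochain set" where
  "hyperplane_class = (SOME x. x \<in> carrier (cohomology_group 2 CP_inf) \<and>
                               is_generator_CP1 (class_pullback 2 (CP 1) id x))"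

text \<open>
  The identification of \<open>\<complex>[[z]]\<close> with the degree \<open>0\<close> cohomology of \<open>\<complex>P\<^sup>\<infinity>\<close>, under which the
  additive coordinate \<open>z\<close> is \<open>\<beta>\<close> times the hyperplane class \<open>x\<close>.
  Thus \<open>a\<^sub>j z\<^sup>j\<close> corresponds to \<open>a\<^sub>j x\<^sup>j \<beta>\<^sup>j\<close>.
\<close>

definition fps_to_Ell :: "complex fps \<Rightarrow> int \<Rightarrow> (nat \<Rightarrow> complex) set cochain set" where
  "fps_to_Ell F = (\<lambda>j. if 0 \<le> j
     then class_scale (2 * j) CP_inf (fps_nth F (nat j)) (cup_power CP_inf hyperplane_class (nat j))
     else Ell_zero 0 CP_inf j)"


section \<open>The elliptic curve and the completion map\<close>

definition period_lattice :: "complex \<Rightarrow> complex set" where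
  "period_lattice \<tau> = {of_int m + of_int n * \<tau> | m n. True}"

definition curve_proj :: "complex \<Rightarrow> complex \<Rightarrow> complex set" where
  "curve_proj \<tau> z = (\<lambda>w. z + w) ` period_lattice \<tau>"

definition elliptic_curve :: "complex \<Rightarrow> complex set set" where
  "elliptic_curve \<tau> = range (curve_proj \<tau>)"

text \<open>
  Sections over \<open>U\<close> of the sheaf of holomorphic functions on \<open>\<complex> / period_lattice \<tau>\<close>, for \<open>U\<close> open in
  the quotient topology.  As the projection is a local biholomorphism, a function is
  holomorphic exactly when its pullback to \<open>\<complex>\<close> is.
\<close>

definition structure_sheaf :: "complex \<Rightarrow> complex set set \<Rightarrow> (complex set \<Rightarrow> complex) set" where
  "structure_sheaf \<tau> U =
     {s \<in> extensional U. (\<lambda>z. s (curve_proj \<tau> z)) holomorphic_on {z. curve_proj \<tau> z \<in> U}}"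

text \<open>
  Global sections over the dual curve, which is also \<open>\<complex> / period_lattice \<tau>\<close>: the degree \<open>0\<close> part of the
  \<open>U(1)\<close>-equivariant elliptic cohomology of a point at this curve.
\<close>

definition Ell_U1_pt :: "complex \<Rightarrow> (complex set \<Rightarrow> complex) set" where
  "Ell_U1_pt \<tau> = structure_sheaf \<tau> (elliptic_curve \<tau>)"

definition completion_map ::
    "complex \<Rightarrow> (complex set \<Rightarrow> complex) \<Rightarrow> int \<Rightarrow> (nat \<Rightarrow> complex) set cochain set" where
  "completion_map \<tau> s = fps_to_Ell (fps_expansion (\<lambda>z. s (curve_proj \<tau> z)) 0)"

end

theory Submission
  imports Defs
begin

text \<open>
  A global section of the structure sheaf is a doubly periodic entire function on \<open>\<complex>\<close>; it is
  bounded, because its values are already taken on a compact fundamental parallelogram, hence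
  constant by Liouville's theorem (\<open>global_section_constant\<close>).  The completion of such a section
  therefore has no term of first order in \<open>z\<close>, whereas a coordinate must have one.

  On the topological side, the coefficient of \<open>\<beta>\<close> in \<open>\<beta> c\<close> is the ordinary degree \<open>2\<close> part of the
  orientation \<open>c\<close>.  If \<open>\<beta> c\<close> were the completion of a section, this part would be \<open>0\<close> times the
  hyperplane class.  Such a multiple contains the zero cocycle, so its restriction to \<open>CP 1\<close>
  contains a cocycle that pairs to \<open>0\<close> with the fundamental cycle
  (\<open>pullback_scale_zero_not_generator\<close>), although the normalisation of an orientation demands
  the value \<open>1\<close>.  Thus the contradiction already appears on cocycles, without computing the
  cohomology of \<open>\<complex>P\<^sup>\<infinity>\<close>.
\<close>

lemma curve_proj_add_period:
  "curve_proj \<tau> (z + (of_int m + of_int n * \<tau>)) = curve_proj \<tau> z"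
proof -
  have "(\<lambda>w. (of_int m + of_int n * \<tau>) + w) ` period_lattice \<tau> = period_lattice \<tau>"
  proof (intro equalityI subsetI)
    fix w assume "w \<in> (\<lambda>w. (of_int m + of_int n * \<tau>) + w) ` period_lattice \<tau>"
    then obtain k l where "w = of_int (m + k) + of_int (n + l) * \<tau>"
      by (auto simp: period_lattice_def algebra_simps)
    then show "w \<in> period_lattice \<tau>" unfolding period_lattice_def by blast
  next
    fix w assume "w \<in> period_lattice \<tau>"
    then obtain k l where "w = of_int k + of_int l * \<tau>"
      by (auto simp: period_lattice_def)
    then have "w = (of_int m + of_int n * \<tau>) + (of_int (k - m) + of_int (l - n) * \<tau>)"
      by (simp add: algebra_simps)
    then show "w \<in> (\<lambda>w. (of_int m + of_int n * \<tau>) + w) ` period_lattice \<tau>"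
      unfolding period_lattice_def by blast
  qed
  then have "(\<lambda>w. z + w) ` (\<lambda>w. (of_int m + of_int n * \<tau>) + w) ` period_lattice \<tau>
      = (\<lambda>w. z + w) ` period_lattice \<tau>"
    by (rule arg_cong)
  then show ?thesis by (simp add: curve_proj_def image_image add.assoc)
qed

text \<open>
  The real coordinates of a point with respect to the basis \<open>1, \<tau>\<close> can be reduced modulo \<open>1\<close>
  independently; \<open>\<tau>\<close> being non-real is what makes this a basis.
\<close>

lemma fundamental_parallelogram:
  assumes "Im \<tau> \<noteq> 0"
  obtains m n :: int and s t :: real
  where "s \<in> {0..1}" "t \<in> {0..1}"
    "z = of_real s + of_real t * \<tau> + (of_int m + of_int n * \<tau>)"
proof -
  define b where "b = Im z / Im \<tau>"
  define a where "a = Re z - b * Re \<tau>"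
  have z: "z = of_real a + of_real b * \<tau>"
    using assms by (simp add: complex_eq_iff a_def b_def)
  have split: "complex_of_real x = of_real (frac x) + of_int \<lfloor>x\<rfloor>" for x
    by (simp add: frac_def)
  have "z = of_real (frac a) + of_real (frac b) * \<tau> + (of_int \<lfloor>a\<rfloor> + of_int \<lfloor>b\<rfloor> * \<tau>)"
    unfolding z by (subst split[of a], subst split[of b]) (simp add: algebra_simps)
  moreover have "frac x \<in> {0..1}" for x :: real
    using frac_lt_1[of x] by (simp add: less_imp_le)
  ultimately show thesis using that by blast
qed

lemma global_section_constant:
  assumes "Im \<tau> \<noteq> 0" and "s \<in> Ell_U1_pt \<tau>"
  shows "(\<lambda>z. s (curve_proj \<tau> z)) constant_on UNIV"
proof -
  define f where "f = (\<lambda>z. s (curve_proj \<tau> z))"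
  define g where "g = (\<lambda>p. complex_of_real (fst p) + of_real (snd p) * \<tau>)"
  have hol: "f holomorphic_on UNIV"
    using assms(2) by (simp add: Ell_U1_pt_def structure_sheaf_def elliptic_curve_def f_def)
  have "range f \<subseteq> f ` g ` ({0..1} \<times> {0..1})"
  proof
    fix y assume "y \<in> range f"
    then obtain z where y: "y = f z" by blast
    obtain m n a b where ab: "a \<in> {0..1}" "b \<in> {0..1}"
      and z: "z = of_real a + of_real b * \<tau> + (of_int m + of_int n * \<tau>)"
      using fundamental_parallelogram[OF assms(1)] .
    have "y = f (g (a, b))"
      unfolding y f_def z curve_proj_add_period by (simp add: g_def)
    then show "y \<in> f ` g ` ({0..1} \<times> {0..1})" using ab by blast
  qed
  moreover have "compact (f ` g ` ({0..1} \<times> {0..1}))"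
  proof (intro compact_continuous_image compact_Times compact_Icc)
    show "continuous_on ({0..1} \<times> {0..1}) g"
      unfolding g_def by (intro continuous_intros)
    show "continuous_on (g ` ({0..1} \<times> {0..1})) f"
      using holomorphic_on_imp_continuous_on[OF hol] continuous_on_subset by blast
  qed
  ultimately have "bounded (range f)"
    using bounded_subset compact_imp_bounded by blast
  with hol have "f constant_on UNIV"
    by (metis Liouville_theorem constant_on_def)
  then show ?thesis by (simp add: f_def)
qed

text \<open>
  The zero class contains the zero cochain, because the latter is its own coboundary.
\<close>

lemma zero_in_zero_class: "(\<lambda>\<sigma>. 0) \<in> cohomology_class k X (\<lambda>\<sigma>. 0)"
proof -
  have "(\<lambda>\<sigma>. 0) \<in> cochains (k - 1) X" by (simp add: cochains_def)
  moreover have "coboundary (k - 1) X (\<lambda>\<sigma>. 0) = (\<lambda>\<sigma>. 0)"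
    by (auto simp: coboundary_def pairing_def)
  ultimately have "(\<lambda>\<sigma>. 0) \<in> coboundaries k X"
    unfolding coboundaries_def by (metis image_eqI)
  then show ?thesis
    by (auto simp: cohomology_class_def r_coset_def cocycle_group_def intro!: bexI)
qed

text \<open>
  Elements of the quotient group are cosets of the coboundaries, and the latter contain \<open>0\<close>.
\<close>

lemma cohomology_carrier_nonempty:
  assumes "u \<in> carrier (cohomology_group k X)"
  shows "u \<noteq> {}"
proof -
  obtain a where u: "u = coboundaries k X #>\<^bsub>cocycle_group k X\<^esub> a"
    using assms by (auto simp: cohomology_group_def FactGroup_def RCOSETS_def)
  have "coboundaries k X \<noteq> {}"
    using zero_in_zero_class[of k X] by (auto simp: cohomology_class_def r_coset_def)
  then show ?thesis by (auto simp: u r_coset_def)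
qed

text \<open>
  A generator pairs to \<open>1\<close> with the fundamental cycle on every representative, which rules out
  the zero cochain.  The set \<open>u\<close> may be empty, but then so is the pullback, which is therefore
  not a cohomology class at all.
\<close>

lemma pullback_scale_zero_not_generator:
  "\<not> is_generator_CP1 (class_pullback 2 (CP 1) f (class_scale 2 X 0 u))"
proof
  assume gen: "is_generator_CP1 (class_pullback 2 (CP 1) f (class_scale 2 X 0 u))"
  show False
  proof (cases "u = {}")
    case True
    then have "class_pullback 2 (CP 1) f (class_scale 2 X 0 u) = {}"
      by (simp add: class_scale_def class_pullback_def)
    with gen show False
      using cohomology_carrier_nonempty unfolding is_generator_CP1_def by metis
  next
    case False
    then have "(\<lambda>\<sigma>. 0) \<in> class_scale 2 X 0 u"
      using zero_in_zero_class[of 2 X] by (auto simp: class_scale_def)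
    moreover have "cochain_pullback 2 (CP 1) f (\<lambda>\<sigma>. 0) = (\<lambda>\<sigma>. 0)"
      by (auto simp: cochain_pullback_def)
    ultimately have "(\<lambda>\<sigma>. 0) \<in> class_pullback 2 (CP 1) f (class_scale 2 X 0 u)"
      unfolding class_pullback_def by (metis UN_I zero_in_zero_class)
    with gen have "pairing (\<lambda>\<sigma>. 0) CP1_fundamental_cycle = 1"
      unfolding is_generator_CP1_def by blast
    then show False by (simp add: pairing_def)
  qed
qed

theorem proposition7p5:
  fixes \<tau> :: complex
    and c_tilde :: "int \<Rightarrow> (nat \<Rightarrow> complex) set cochain set"
  assumes "Im \<tau> > 0"
    and "MU_orientation c_tilde"
  shows "\<not> (\<exists>c_U1 \<in> Ell_U1_pt \<tau>. completion_map \<tau> c_U1 = beta_mult c_tilde)"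
proof
  assume "\<exists>c_U1 \<in> Ell_U1_pt \<tau>. completion_map \<tau> c_U1 = beta_mult c_tilde"
  then obtain s where s: "s \<in> Ell_U1_pt \<tau>"
    and eq: "completion_map \<tau> s = beta_mult c_tilde" by blast
  obtain a where const: "(\<lambda>z. s (curve_proj \<tau> z)) = (\<lambda>z. a)"
    using global_section_constant[OF _ s] assms(1) by (auto simp: constant_on_def)
  have "fps_nth (fps_expansion (\<lambda>z. s (curve_proj \<tau> z)) 0) 1 = 0"
    unfolding const by (simp add: fps_expansion_def)
  then have "completion_map \<tau> s 1 = class_scale 2 CP_inf 0 (cup_power CP_inf hyperplane_class 1)"
    by (simp add: completion_map_def fps_to_Ell_def)
  \<comment> \<open>multiplication by \<open>\<beta>\<close> shifts the index: the \<open>\<beta>\<close>-coefficient of \<open>\<beta> c\<close> is \<open>c_tilde 0\<close>\<close>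
  then have "c_tilde 0 = class_scale 2 CP_inf 0 (cup_power CP_inf hyperplane_class 1)"
    by (simp add: eq beta_mult_def)
  moreover have "is_generator_CP1 (class_pullback 2 (CP 1) id (c_tilde 0))"
    using assms(2) by (simp add: MU_orientation_def is_Ell_generator_CP1_def Ell_pullback_def)
  ultimately show False using pullback_scale_zero_not_generator by metis
qed

end
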